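(* Let $n>0$. The lattice $\mathcal{D}_{n}^{B}=(D_n^B,\leq_D)$ of Dyck paths of type $B$ of semilength $n$ under dominance order is a Heyting algebra. The subset $D_n^A\subseteq D_n^B$ of Dyck paths of type $A$ of semilength $n$ forms a sublattice $\mathcal{D}_n^A$ of $\mathcal{D}_n^B$ which is itself a Heyting algebra, but $\mathcal{D}_n^A$ is not a Heyting subalgebra of $\mathcal{D}_n^B$. Conversely, $\mathcal{D}_n^B$ is a Heyting subalgebra of $\mathcal{D}_{2n}^A$, in the following sense: the map $\varphi:D_n^B\to D_{2n}^A$, $w\mapsto w\,\psi(w)$, is a lattice isomorphism from $\mathcal{D}_n^B$ onto the set of centrally symmetric Dyck words $\{v\in D_{2n}^A\mid \psi(v)=v\}$, and this set is a Heyting subalgebra of $\mathcal{D}_{2n}^A$.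
   Context: Dyck paths are identified with words over $\{u,r\}$ ($u$ an up-step $(0,1)$, $r$ a right-step $(1,0)$, path starting at $(0,0)$). $D_n^B$ is the set of words $w$ of length $2n$ over $\{u,r\}$ in which every prefix contains at least as many $u$'s as $r$'s; $D_n^A\subseteq D_n^B$ consists of those containing exactly $n$ letters $u$ (and $n$ letters $r$). Height sequence of $w\in D_n^B$: let $\rho$ be the number of $r$'s in $w$. If $w$ ends with $r$, put $k=\rho$ and let $h_i$ be the number of $u$'s preceding the $i$-th $r$; if $w$ ends with $u$, put $k=\rho+1$, let $h_i$ ($i\le\rho$) be the number of $u$'s preceding the $i$-th $r$, and let $h_k$ be the total number of $u$'s in $w$. Dominance order: $w\leq_D w'$ with height sequences $(h_1,\dots,h_k)$, $(h'_1,\dots,h'_{k'})$ iff $k\geq k'$ and $h_i\le h'_i$ for all $i\in[k']$. For $w\in D_n^A$ the height sequence is $(h_1,\dots,h_n)$ with $h_i$ the number of $u$'s before the $i$-th $r$, and on $D_n^A$ the dominance order is componentwise comparison. For a word $w$ over $\{u,r\}$, $\psi(w)$ is the word obtained by replacing every $u$ by $r$ and every $r$ by $u$ and then reversing the order of the letters. A lattice with $\hat0,\hat1$ is a Heyting algebra if for all $x,y$ there is a greatest $z$ (the relative pseudocomplement $x\to y$) with $x\wedge z\le y$. A Heyting subalgebra is a subset containing $\hat0$ and $\hat1$ and closed under $\wedge$, $\vee$ and $\to$ (computed in the ambient algebra). *)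

theory Defs
  imports "HOL-Algebra.Lattice" "HOL-Library.Sublist"
begin

text \<open>
  As for \<open>sup\<close> and \<open>inf\<close> in \<open>HOL-Algebra\<close>, the relative pseudocomplement is chosen by
  \<open>SOME\<close>; in a partial order it is unique whenever it exists.
\<close>

definition rel_pseudocompl :: "('a, 'b) gorder_scheme \<Rightarrow> 'a \<Rightarrow> 'a \<Rightarrow> 'a" where
  "rel_pseudocompl L x y =
     (SOME z. greatest L z {z \<in> carrier L. x \<sqinter>\<^bsub>L\<^esub> z \<sqsubseteq>\<^bsub>L\<^esub> y})"

locale heyting_algebra = bounded_lattice +
  assumes rel_pseudocompl_exists:
    "\<lbrakk>x \<in> carrier L; y \<in> carrier L\<rbrakk> \<Longrightarrow>
       \<exists>z. greatest L z {z \<in> carrier L. x \<sqinter> z \<sqsubseteq> y}"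

definition sublattice :: "'a set \<Rightarrow> ('a, 'b) gorder_scheme \<Rightarrow> bool" where
  "sublattice S L \<longleftrightarrow>
     S \<subseteq> carrier L \<and> S \<noteq> {} \<and>
     (\<forall>x\<in>S. \<forall>y\<in>S. x \<sqinter>\<^bsub>L\<^esub> y \<in> S \<and> x \<squnion>\<^bsub>L\<^esub> y \<in> S)"

definition heyting_subalgebra :: "'a set \<Rightarrow> ('a, 'b) gorder_scheme \<Rightarrow> bool" where
  "heyting_subalgebra S L \<longleftrightarrow>
     S \<subseteq> carrier L \<and> \<bottom>\<^bsub>L\<^esub> \<in> S \<and> \<top>\<^bsub>L\<^esub> \<in> S \<and>
     (\<forall>x\<in>S. \<forall>y\<in>S. x \<sqinter>\<^bsub>L\<^esub> y \<in> S \<and> x \<squnion>\<^bsub>L\<^esub> y \<in> S \<and> rel_pseudocompl L x y \<in> S)"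

text \<open>\<open>join_pres\<close> and \<open>meet_pres\<close> include that both structures are lattices.\<close>

definition lattice_iso ::
  "('a, 'c) gorder_scheme \<Rightarrow> ('b, 'd) gorder_scheme \<Rightarrow> ('a \<Rightarrow> 'b) \<Rightarrow> bool" where
  "lattice_iso L M f \<longleftrightarrow>
     bij_betw f (carrier L) (carrier M) \<and> join_pres L M f \<and> meet_pres L M f"


datatype step = Up | Right

type_synonym word = "step list"

definition dyck_B :: "nat \<Rightarrow> word set" where
  "dyck_B n = {w. length w = 2 * n \<and>
                  (\<forall>p. prefix p w \<longrightarrow> count_list p Right \<le> count_list p Up)}"

definition dyck_A :: "nat \<Rightarrow> word set" where
  "dyck_A n = {w \<in> dyck_B n. count_list w Up = n}"

text \<open>
  The heights are stored from index \<open>0\<close>, so \<open>heights w ! (i - 1)\<close> is the height \<open>h\<^sub>i\<close>.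
  The first part runs over the positions of the letters \<^term>\<open>Right\<close>, in increasing order.
\<close>

definition heights :: "word \<Rightarrow> nat list" where
  "heights w =
     map (\<lambda>j. count_list (take j w) Up) (filter (\<lambda>j. w ! j = Right) [0..<length w])
     @ (if w \<noteq> [] \<and> last w = Up then [count_list w Up] else [])"

definition dominance :: "word \<Rightarrow> word \<Rightarrow> bool" where
  "dominance w w' \<longleftrightarrow>
     length (heights w') \<le> length (heights w) \<and>
     (\<forall>i < length (heights w'). heights w ! i \<le> heights w' ! i)"

definition dyck_lattice_B :: "nat \<Rightarrow> word gorder" where
  "dyck_lattice_B n = \<lparr>carrier = dyck_B n, eq = (=), le = dominance\<rparr>"

definition dyck_lattice_A :: "nat \<Rightarrow> word gorder" where
  "dyck_lattice_A n = \<lparr>carrier = dyck_A n, eq = (=), le = dominance\<rparr>"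

fun swap_step :: "step \<Rightarrow> step" where
  "swap_step Up = Right"
| "swap_step Right = Up"

definition psi :: "word \<Rightarrow> word" where
  "psi w = rev (map swap_step w)"

definition phi :: "word \<Rightarrow> word" where
  "phi w = w @ psi w"

definition symmetric_dyck_A :: "nat \<Rightarrow> word set" where
  "symmetric_dyck_A m = {v \<in> dyck_A m. psi v = v}"

end

theory Submission
  imports Defs
begin

text \<open>
  For words of a fixed length, dominance is the pointwise comparison of the numbers of
  up-steps in the prefixes of each length.  Pointwise minima and maxima of such counting functions
  are again counting functions, and the conditions defining \<open>D\<^sub>n\<^sup>B\<close>, \<open>D\<^sub>n\<^sup>A\<close> and the symmetric words
  are stable under them; so all three are finite distributive lattices, hence Heyting algebras.
  The top element of \<open>D\<^sub>n\<^sup>B\<close> consists of up-steps only and is not in \<open>D\<^sub>n\<^sup>A\<close>.  Finally, \<open>\<psi>\<close> is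
  an order automorphism of \<open>D\<^sub>m\<^sup>A\<close>, and the fixed points of an automorphism form a Heyting
  subalgebra.
\<close>

section \<open>Finite distributive lattices and automorphisms\<close>

text \<open>Every finite subset \<open>B\<close> of \<open>A\<close> has an upper bound inside
  \<open>A\<close>, built up by joins; the case \<open>B = A\<close> is the claim. The induction
  keeps \<open>A\<close> fixed because subsets of \<open>A\<close> need not be closed under
  joins.\<close>

lemma (in weak_upper_semilattice) finite_join_closed_greatest:
  assumes "finite A" "A \<noteq> {}" "A \<subseteq> carrier L"
    and join: "\<And>x y. x \<in> A \<Longrightarrow> y \<in> A \<Longrightarrow> x \<squnion> y \<in> A"
  shows "\<exists>z. greatest L z A"
proof -
  have "\<exists>u\<in>A. \<forall>x\<in>B. x \<sqsubseteq> u" if "finite B" "B \<subseteq> A" for B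
    using that
  proof (induction rule: finite_induct)
    case empty
    then show ?case using \<open>A \<noteq> {}\<close> by blast
  next
    case (insert b B)
    then obtain u where u: "u \<in> A" "\<forall>x\<in>B. x \<sqsubseteq> u" by auto
    have carr: "b \<in> carrier L" "u \<in> carrier L" "B \<subseteq> carrier L"
      using insert.prems u(1) assms(3) by auto
    have "\<forall>x\<in>insert b B. x \<sqsubseteq> u \<squnion> b"
      using u(2) carr join_left[of u b] join_right[of u b] join_closed[of u b]
      by (blast intro: le_trans)
    moreover have "u \<squnion> b \<in> A" using insert.prems u(1) join by simp
    ultimately show ?case by blast
  qed
  from this[OF assms(1) subset_refl] show ?thesis
    using assms(3) unfolding greatest_def by blast
qed

text \<open>Distributivity makes the set of all \<open>z\<close> with
  \<open>x \<sqinter> z \<sqsubseteq> y\<close> closed under joins, so by finiteness it has a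
  greatest element.\<close>

lemma (in lattice) finite_distributive_heyting_algebra:
  assumes fin: "finite (carrier L)" and ne: "carrier L \<noteq> {}"
    and distrib: "\<And>x y z. x \<in> carrier L \<Longrightarrow> y \<in> carrier L \<Longrightarrow> z \<in> carrier L \<Longrightarrow>
      x \<sqinter> (y \<squnion> z) = (x \<sqinter> y) \<squnion> (x \<sqinter> z)"
  shows "heyting_algebra L"
proof unfold_locales
  have "greatest L (\<Sqinter>carrier L) (Lower L (carrier L))"
    using fin ne by (intro finite_inf_greatest) auto
  then show "\<exists>x. least L x (carrier L)"
    unfolding greatest_def least_def Lower_def by blast
  show "\<exists>x. greatest L x (carrier L)"
    using fin ne by (intro finite_join_closed_greatest) auto
next
  fix x y
  assume xy: "x \<in> carrier L" "y \<in> carrier L"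
  show "\<exists>z. greatest L z {z \<in> carrier L. x \<sqinter> z \<sqsubseteq> y}"
  proof (rule finite_join_closed_greatest)
    show "finite {z \<in> carrier L. x \<sqinter> z \<sqsubseteq> y}" using fin by simp
    \<comment> \<open>The element \<open>y\<close> itself is a witness.\<close>
    show "{z \<in> carrier L. x \<sqinter> z \<sqsubseteq> y} \<noteq> {}" using xy meet_right by blast
    show "{z \<in> carrier L. x \<sqinter> z \<sqsubseteq> y} \<subseteq> carrier L" by blast
    show "u \<squnion> v \<in> {z \<in> carrier L. x \<sqinter> z \<sqsubseteq> y}"
      if "u \<in> {z \<in> carrier L. x \<sqinter> z \<sqsubseteq> y}" "v \<in> {z \<in> carrier L. x \<sqinter> z \<sqsubseteq> y}" for u v
      using that xy distrib by (auto intro!: join_le)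
  qed
qed

lemma order_iso_lattice_iso:
  assumes L: "lattice L" and M: "lattice M"
    and bij: "bij_betw f (carrier L) (carrier M)"
    and le_iff: "\<And>x y. x \<in> carrier L \<Longrightarrow> y \<in> carrier L \<Longrightarrow>
      f x \<sqsubseteq>\<^bsub>M\<^esub> f y \<longleftrightarrow> x \<sqsubseteq>\<^bsub>L\<^esub> y"
  shows "lattice_iso L M f"
proof -
  interpret L: lattice L by fact
  interpret M: lattice M by fact
  have f: "f x \<in> carrier M" if "x \<in> carrier L" for x
    using bij that by (auto simp: bij_betw_def)
  have surj: "\<exists>x\<in>carrier L. z = f x" if "z \<in> carrier M" for z
    using bij that by (auto simp: bij_betw_def)
  have "f (x \<squnion>\<^bsub>L\<^esub> y) = f x \<squnion>\<^bsub>M\<^esub> f y" if xy: "x \<in> carrier L" "y \<in> carrier L" for x y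
  proof -
    \<comment> \<open>Pulled back along \<open>f\<close>, the join in \<open>M\<close> becomes an
      upper bound \<open>z\<close> of \<open>x\<close> and \<open>y\<close>, hence lies above their
      join in \<open>L\<close>.\<close>
    obtain z where z: "z \<in> carrier L" "f x \<squnion>\<^bsub>M\<^esub> f y = f z"
      using surj f xy by (meson M.join_closed)
    have "x \<sqsubseteq>\<^bsub>L\<^esub> z" "y \<sqsubseteq>\<^bsub>L\<^esub> z"
      using M.join_left[of "f x" "f y"] M.join_right[of "f x" "f y"] z xy f le_iff by auto
    then have "f (x \<squnion>\<^bsub>L\<^esub> y) \<sqsubseteq>\<^bsub>M\<^esub> f z"
      using le_iff xy z by (simp add: L.join_le)
    moreover have "f x \<squnion>\<^bsub>M\<^esub> f y \<sqsubseteq>\<^bsub>M\<^esub> f (x \<squnion>\<^bsub>L\<^esub> y)"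
      using xy f le_iff by (intro M.join_le) (auto intro: L.join_left L.join_right)
    ultimately show ?thesis using M.le_antisym f xy z by simp
  qed
  moreover have "f (x \<sqinter>\<^bsub>L\<^esub> y) = f x \<sqinter>\<^bsub>M\<^esub> f y"
    if xy: "x \<in> carrier L" "y \<in> carrier L" for x y
  proof -
    obtain z where z: "z \<in> carrier L" "f x \<sqinter>\<^bsub>M\<^esub> f y = f z"
      using surj f xy by (meson M.meet_closed)
    have "z \<sqsubseteq>\<^bsub>L\<^esub> x" "z \<sqsubseteq>\<^bsub>L\<^esub> y"
      using M.meet_left[of "f x" "f y"] M.meet_right[of "f x" "f y"] z xy f le_iff by auto
    then have "f z \<sqsubseteq>\<^bsub>M\<^esub> f (x \<sqinter>\<^bsub>L\<^esub> y)"
      using le_iff xy z by (simp add: L.meet_le)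
    moreover have "f (x \<sqinter>\<^bsub>L\<^esub> y) \<sqsubseteq>\<^bsub>M\<^esub> f x \<sqinter>\<^bsub>M\<^esub> f y"
      using xy f le_iff by (intro M.meet_le) (auto intro: L.meet_left L.meet_right)
    ultimately show ?thesis using M.le_antisym f xy z by simp
  qed
  ultimately show ?thesis
    using L M bij unfolding lattice_iso_def join_pres_def meet_pres_def by blast
qed

lemma (in heyting_algebra) rel_pseudocompl_greatest:
  assumes "x \<in> carrier L" "y \<in> carrier L"
  shows "greatest L (rel_pseudocompl L x y) {z \<in> carrier L. x \<sqinter> z \<sqsubseteq> y}"
  unfolding rel_pseudocompl_def using rel_pseudocompl_exists[OF assms] by (rule someI_ex)

text \<open>For fixed points \<open>x\<close> and \<open>y\<close>, the set whose greatest element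
  is the relative pseudocomplement is invariant under \<open>g\<close>, so that element is fixed as
  well.\<close>

lemma (in heyting_algebra) fixed_points_heyting_subalgebra:
  assumes bij: "bij_betw g (carrier L) (carrier L)"
    and le_iff: "\<And>x y. x \<in> carrier L \<Longrightarrow> y \<in> carrier L \<Longrightarrow> g x \<sqsubseteq> g y \<longleftrightarrow> x \<sqsubseteq> y"
  shows "heyting_subalgebra {x \<in> carrier L. g x = x} L"
proof -
  have "lattice_iso L L g"
    using lattice_axioms lattice_axioms bij le_iff by (rule order_iso_lattice_iso)
  then have hom: "g (x \<squnion> y) = g x \<squnion> g y" "g (x \<sqinter> y) = g x \<sqinter> g y"
    if "x \<in> carrier L" "y \<in> carrier L" for x y
    using that unfolding lattice_iso_def join_pres_def meet_pres_def by auto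
  have g: "g x \<in> carrier L" if "x \<in> carrier L" for x
    using bij that by (auto simp: bij_betw_def)
  have surj: "\<exists>x\<in>carrier L. z = g x" if "z \<in> carrier L" for z
    using bij that by (auto simp: bij_betw_def)
  have "g \<top> = \<top>"
    by (rule top_eq) (use surj le_iff g in force)+
  moreover have "g \<bottom> = \<bottom>"
    by (rule bottom_eq) (use surj le_iff g in force)+
  moreover have "rel_pseudocompl L x y \<in> {x \<in> carrier L. g x = x}"
    if xy: "x \<in> carrier L" "y \<in> carrier L" "g x = x" "g y = y" for x y
  proof -
    let ?z = "rel_pseudocompl L x y"
    have z: "?z \<in> carrier L" "x \<sqinter> ?z \<sqsubseteq> y"
      and zmax: "\<And>u. u \<in> carrier L \<Longrightarrow> x \<sqinter> u \<sqsubseteq> y \<Longrightarrow> u \<sqsubseteq> ?z"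
      using rel_pseudocompl_greatest[OF xy(1,2)] unfolding greatest_def by auto
    have sound: "x \<sqinter> g u \<sqsubseteq> y \<longleftrightarrow> x \<sqinter> u \<sqsubseteq> y" if "u \<in> carrier L" for u
      using le_iff[of "x \<sqinter> u" y] hom(2)[of x u] that xy by simp
    have "g ?z \<sqsubseteq> ?z" using zmax g z sound by blast
    \<comment> \<open>For the converse inequality, the preimage \<open>u\<close> of
      \<open>?z\<close> also satisfies the defining condition, so it lies below \<open>?z\<close>;
      now apply \<open>g\<close>.\<close>
    moreover obtain u where u: "u \<in> carrier L" "?z = g u" using surj z(1) by blast
    have "u \<sqsubseteq> ?z" using zmax sound u z by metis
    then have "?z \<sqsubseteq> g ?z" using le_iff[of u ?z] u z by simp
    ultimately show ?thesis using z(1) g by (simp add: le_antisym)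
  qed
  ultimately show ?thesis
    unfolding heyting_subalgebra_def by (auto simp: hom)
qed

section \<open>Prefix counts\<close>

definition ups :: "word \<Rightarrow> nat \<Rightarrow> nat" where
  "ups w j = count_list (take j w) Up"

lemma count_list_Up_Right: "count_list w Up + count_list w Right = length w"
proof (induction w)
  case (Cons a w)
  then show ?case by (cases a) auto
qed simp

lemma ups_0 [simp]: "ups w 0 = 0"
  by (simp add: ups_def)

lemma ups_Suc: "j < length w \<Longrightarrow> ups w (Suc j) = ups w j + (if w ! j = Up then 1 else 0)"
  by (simp add: ups_def take_Suc_conv_app_nth)

lemma ups_add_Right: "j \<le> length w \<Longrightarrow> ups w j + count_list (take j w) Right = j"
  using count_list_Up_Right[of "take j w"] by (simp add: ups_def)

text \<open>The letter at position \<open>i\<close> is recovered from the increment of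
  \<open>ups\<close> between \<open>i\<close> and \<open>Suc i\<close>.\<close>

lemma word_eqI_ups:
  assumes "length x = length y" "\<And>j. j \<le> length x \<Longrightarrow> ups x j = ups y j"
  shows "x = y"
proof (rule nth_equalityI)
  fix i assume "i < length x"
  then have "(x ! i = Up) = (y ! i = Up)"
    using assms(2)[of i] assms(2)[of "Suc i"] assms(1) ups_Suc[of i x] ups_Suc[of i y]
    by (auto split: if_splits)
  then show "x ! i = y ! i" by (cases "x ! i"; cases "y ! i") auto
qed fact

definition word_of_ups :: "nat \<Rightarrow> (nat \<Rightarrow> nat) \<Rightarrow> word" where
  "word_of_ups N f = map (\<lambda>j. if f (Suc j) = f j then Right else Up) [0..<N]"

lemma length_word_of_ups [simp]: "length (word_of_ups N f) = N"
  by (simp add: word_of_ups_def)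

text \<open>The counting functions of words are exactly those that start at 0 and grow by 0 or 1 at
  each step.\<close>

lemma ups_word_of_ups:
  assumes "f 0 = 0" "\<And>j. j < N \<Longrightarrow> f (Suc j) = f j \<or> f (Suc j) = Suc (f j)" "j \<le> N"
  shows "ups (word_of_ups N f) j = f j"
  using assms(3)
proof (induction j)
  case (Suc j)
  then show ?case
    using assms(2)[of j] by (auto simp: ups_Suc word_of_ups_def)
qed (simp add: assms(1))

definition path_min :: "word \<Rightarrow> word \<Rightarrow> word" where
  "path_min x y = word_of_ups (length x) (\<lambda>j. min (ups x j) (ups y j))"

definition path_max :: "word \<Rightarrow> word \<Rightarrow> word" where
  "path_max x y = word_of_ups (length x) (\<lambda>j. max (ups x j) (ups y j))"

lemma length_path_min [simp]: "length (path_min x y) = length x"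
  and length_path_max [simp]: "length (path_max x y) = length x"
  by (simp_all add: path_min_def path_max_def)

text \<open>Being nondecreasing with increments at most 1 passes from two functions to their
  pointwise minimum and maximum, so both are counting functions again.\<close>

lemma ups_path_min:
  "length x = length y \<Longrightarrow> j \<le> length x \<Longrightarrow> ups (path_min x y) j = min (ups x j) (ups y j)"
  unfolding path_min_def by (subst ups_word_of_ups) (auto simp: ups_Suc min_def)

lemma ups_path_max:
  "length x = length y \<Longrightarrow> j \<le> length x \<Longrightarrow> ups (path_max x y) j = max (ups x j) (ups y j)"
  unfolding path_max_def by (subst ups_word_of_ups) (auto simp: ups_Suc max_def)

section \<open>Dominance as pointwise comparison\<close>

text \<open>
  The positions underlying the height sequence: a final up-step contributes the virtual
  right-step at position \<open>length w\<close>.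
\<close>

definition right_positions :: "word \<Rightarrow> nat list" where
  "right_positions w = filter (\<lambda>j. w ! j = Right) [0..<length w]
     @ (if w \<noteq> [] \<and> last w = Up then [length w] else [])"

lemma heights_conv_right_positions: "heights w = map (ups w) (right_positions w)"
  by (simp add: heights_def right_positions_def ups_def fun_eq_iff)

lemma sorted_right_positions: "sorted_wrt (<) (right_positions w)"
  by (auto simp: right_positions_def sorted_wrt_append sorted_wrt_filter)

text \<open>The strict bound \<open>k < j\<close> together with \<open>j \<le> length w\<close>
  excludes the virtual position, so only genuine letters are counted.\<close>

lemma set_right_positions_below:
  "j \<le> length w \<Longrightarrow> {k \<in> set (right_positions w). k < j} = {k. k < j \<and> w ! k = Right}"
  by (auto simp: right_positions_def)

lemma right_positions_le: "k \<in> set (right_positions w) \<Longrightarrow> k \<le> length w"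
  by (auto simp: right_positions_def split: if_splits)

lemma count_list_take_Right:
  "j \<le> length w \<Longrightarrow> count_list (take j w) Right = card {k \<in> set (right_positions w). k < j}"
proof -
  assume j: "j \<le> length w"
  then have "count_list (take j w) Right = card {k. k < j \<and> w ! k = Right}"
    by (auto simp: count_list_eq_length_filter length_filter_conv_card min_absorb2
        intro!: arg_cong[where f = card])
  then show ?thesis using set_right_positions_below[OF j] by simp
qed

lemma strict_sorted_below_nth:
  fixes xs :: "'a :: linorder list"
  assumes "sorted_wrt (<) xs" "i < length xs"
  shows "{k \<in> set xs. k < xs ! i} = set (take i xs)"
proof -
  have less_iff: "xs ! j < xs ! i \<longleftrightarrow> j < i" if "j < length xs" for j
    using sorted_wrt_nth_less[OF assms(1)] assms(2) that
    by (metis less_asym linorder_neqE_nat order.irrefl)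
  have "set (take i xs) = (\<lambda>j. xs ! j) ` {..<i}"
    using assms(2) nth_image[of i xs] by (simp add: lessThan_atLeast0)
  also have "\<dots> = {k \<in> set xs. k < xs ! i}"
    using assms(2) less_iff by (auto simp: in_set_conv_nth dest: less_trans)
  finally show ?thesis by simp
qed

lemma strict_sorted_card_below_nth:
  fixes xs :: "'a :: linorder list"
  assumes "sorted_wrt (<) xs" "i < length xs"
  shows "card {k \<in> set xs. k < xs ! i} = i"
  unfolding strict_sorted_below_nth[OF assms]
  using assms by (simp add: distinct_card strict_sorted_iff)

text \<open>The position with index \<open>i\<close> is preceded by \<open>i\<close> right-steps and
  \<open>heights w ! i\<close> up-steps. Heights and positions thus differ by a shift that depends
  on the index only, not on the word.\<close>

lemma heights_nth:
  assumes "i < length (right_positions w)"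
  shows "heights w ! i + i = right_positions w ! i"
proof -
  have le: "right_positions w ! i \<le> length w"
    using assms right_positions_le nth_mem by blast
  then have "count_list (take (right_positions w ! i) w) Right = i"
    using count_list_take_Right strict_sorted_card_below_nth[OF sorted_right_positions assms]
    by simp
  then show ?thesis
    using ups_add_Right[OF le] assms by (simp add: heights_conv_right_positions)
qed

text \<open>The last letter always contributes exactly one entry: its own position if it is
  \<open>Right\<close>, the virtual one if it is \<open>Up\<close>.\<close>

lemma length_right_positions:
  assumes "w \<noteq> []"
  shows "length (right_positions w) = Suc (count_list (butlast w) Right)"
proof -
  let ?N = "length w - 1"
  have N: "length w = Suc ?N" using assms by simp
  have "length (filter (\<lambda>j. w ! j = Right) [0..<?N]) = count_list (butlast w) Right"
    by (simp add: count_list_eq_length_filter length_filter_conv_card nth_butlast)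
      (auto intro!: arg_cong[where f = card] simp: nth_butlast)
  moreover have "last w = w ! ?N" using assms by (rule last_conv_nth)
  moreover have "[0..<length w] = [0..<?N] @ [?N]" by (subst N) simp
  ultimately show ?thesis
    unfolding right_positions_def using assms by (cases "w ! ?N") auto
qed

lemma dominance_conv_right_positions:
  "dominance x y \<longleftrightarrow> length (right_positions y) \<le> length (right_positions x) \<and>
     (\<forall>i < length (right_positions y). right_positions x ! i \<le> right_positions y ! i)"
proof -
  have "heights x ! i \<le> heights y ! i \<longleftrightarrow> right_positions x ! i \<le> right_positions y ! i"
    if "i < length (right_positions x)" "i < length (right_positions y)" for i
    using heights_nth[OF that(1)] heights_nth[OF that(2)] by linarith
  then show ?thesis
    unfolding dominance_def by (auto simp: heights_conv_right_positions)
qed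

text \<open>Dominance says that each right-step of \<open>x\<close> comes no later than the
  corresponding one of \<open>y\<close>. Equivalently, every prefix of \<open>x\<close> has at least
  as many right-steps as that of \<open>y\<close>, hence at most as many up-steps.\<close>

lemma dominance_iff_ups:
  assumes len: "length x = length y"
  shows "dominance x y \<longleftrightarrow> (\<forall>j \<le> length x. ups x j \<le> ups y j)"
proof
  assume dom: "dominance x y"
  show "\<forall>j \<le> length x. ups x j \<le> ups y j"
  proof (intro allI impI)
    fix j assume j: "j \<le> length x"
    have card: "card {k \<in> set xs. k < j} = card {i. i < length xs \<and> xs ! i < j}"
      if "sorted_wrt (<) xs" for xs :: "nat list"
    proof -
      have "{k \<in> set xs. k < j} = (\<lambda>i. xs ! i) ` {i. i < length xs \<and> xs ! i < j}"
        by (auto simp: in_set_conv_nth)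
      moreover have "inj_on (\<lambda>i. xs ! i) {i. i < length xs \<and> xs ! i < j}"
        using that by (auto simp: inj_on_def strict_sorted_iff nth_eq_iff_index_eq)
      ultimately show ?thesis by (simp add: card_image)
    qed
    \<comment> \<open>Counting indices instead of positions turns the entrywise comparison into an
      inclusion.\<close>
    have "{i. i < length (right_positions y) \<and> right_positions y ! i < j}
        \<subseteq> {i. i < length (right_positions x) \<and> right_positions x ! i < j}"
      using dom unfolding dominance_conv_right_positions by fastforce
    then have "count_list (take j y) Right \<le> count_list (take j x) Right"
      using j len by (simp add: count_list_take_Right card sorted_right_positions card_mono)
    then show "ups x j \<le> ups y j"
      using ups_add_Right[of j x] ups_add_Right[of j y] j len by linarith
  qed
next
  assume *: "\<forall>j \<le> length x. ups x j \<le> ups y j"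
  have R: "count_list (take j y) Right \<le> count_list (take j x) Right" if "j \<le> length x" for j
    using ups_add_Right[of j x] ups_add_Right[of j y] * that len by fastforce
  have lens: "length (right_positions y) \<le> length (right_positions x)"
  proof (cases "x = []")
    case False
    then show ?thesis
      \<comment> \<open>The prefix without the last letter determines the number of
        positions.\<close>
      using R[of "length x - 1"] len
      by (subst (1 2) length_right_positions) (auto simp: butlast_conv_take)
  qed (use len in simp)
  moreover have "right_positions x ! i \<le> right_positions y ! i"
    if i: "i < length (right_positions y)" for i
  proof (rule ccontr)
    assume "\<not> ?thesis"
    then have less: "right_positions y ! i < right_positions x ! i" by simp
    \<comment> \<open>Cut just after the entry of \<open>y\<close> with index \<open>i\<close>:
      below \<open>?j\<close> there are \<open>i + 1\<close> positions of \<open>y\<close> but at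
      most \<open>i\<close> of \<open>x\<close>. Since \<open>?j \<le> length x\<close>, that entry
      of \<open>y\<close> is not the virtual one.\<close>
    let ?j = "Suc (right_positions y ! i)"
    have ix: "i < length (right_positions x)" using i lens by simp
    have j: "?j \<le> length x"
      using less right_positions_le[OF nth_mem[OF ix]] by simp
    have "card {k \<in> set (right_positions x). k < ?j}
        \<le> card {k \<in> set (right_positions x). k < right_positions x ! i}"
      by (rule card_mono) (use less in auto)
    then have "card {k \<in> set (right_positions x). k < ?j} \<le> i"
      using strict_sorted_card_below_nth[OF sorted_right_positions ix] by simp
    moreover have "{k \<in> set (right_positions y). k < ?j}
        = insert (right_positions y ! i) {k \<in> set (right_positions y). k < right_positions y ! i}"
      using i by auto
    then have "card {k \<in> set (right_positions y). k < ?j} = Suc i"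
      using strict_sorted_card_below_nth[OF sorted_right_positions i] by simp
    ultimately show False
      using R[OF j] j len by (simp add: count_list_take_Right)
  qed
  ultimately show "dominance x y" by (simp add: dominance_conv_right_positions)
qed

section \<open>Lattices of words\<close>

abbreviation word_order :: "word set \<Rightarrow> word gorder" where
  "word_order S \<equiv> \<lparr>carrier = S, eq = (=), le = dominance\<rparr>"

text \<open>Common frame for type B, type A and symmetric words, so that the Heyting structure is
  established once for all three.\<close>

locale path_family =
  fixes S :: "word set" and N :: nat
  assumes length_mem: "w \<in> S \<Longrightarrow> length w = N"
    and nonempty: "S \<noteq> {}"
    and path_min_closed: "x \<in> S \<Longrightarrow> y \<in> S \<Longrightarrow> path_min x y \<in> S"
    and path_max_closed: "x \<in> S \<Longrightarrow> y \<in> S \<Longrightarrow> path_max x y \<in> S"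
begin

lemma dominance_iff: "x \<in> S \<Longrightarrow> y \<in> S \<Longrightarrow> dominance x y \<longleftrightarrow> (\<forall>j\<le>N. ups x j \<le> ups y j)"
  using length_mem dominance_iff_ups by simp

lemma finite_family: "finite S"
proof -
  have "(UNIV :: step set) = {Up, Right}"
    using step.exhaust by auto
  then have "finite (UNIV :: step set)" by (metis finite.simps)
  from finite_lists_length_eq[OF this, of N] show ?thesis
    by (rule finite_subset[rotated]) (use length_mem in auto)
qed

lemma ups_min: "x \<in> S \<Longrightarrow> y \<in> S \<Longrightarrow> j \<le> N \<Longrightarrow> ups (path_min x y) j = min (ups x j) (ups y j)"
  using length_mem ups_path_min by simp

lemma ups_max: "x \<in> S \<Longrightarrow> y \<in> S \<Longrightarrow> j \<le> N \<Longrightarrow> ups (path_max x y) j = max (ups x j) (ups y j)"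
  using length_mem ups_path_max by simp

lemma partial_order_words: "partial_order (word_order S)"
proof unfold_locales
  fix x y
  assume "x \<sqsubseteq>\<^bsub>word_order S\<^esub> y" "y \<sqsubseteq>\<^bsub>word_order S\<^esub> x"
    "x \<in> carrier (word_order S)" "y \<in> carrier (word_order S)"
  then show "x .=\<^bsub>word_order S\<^esub> y"
    using length_mem by (auto simp: dominance_iff intro!: word_eqI_ups le_antisym)
qed (auto simp: dominance_iff intro: le_trans)

lemma least_path_max:
  "x \<in> S \<Longrightarrow> y \<in> S \<Longrightarrow>
    least (word_order S) (path_max x y) (Upper (word_order S) {x, y})"
  by (auto simp: least_def Upper_def dominance_iff path_max_closed ups_max)

lemma greatest_path_min:
  "x \<in> S \<Longrightarrow> y \<in> S \<Longrightarrow>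
    greatest (word_order S) (path_min x y) (Lower (word_order S) {x, y})"
  by (auto simp: greatest_def Lower_def dominance_iff path_min_closed ups_min)

sublocale lattice "word_order S"
proof (intro lattice.intro upper_semilattice.intro lower_semilattice.intro partial_order_words)
  show "upper_semilattice_axioms (word_order S)"
    by unfold_locales (use least_path_max in auto)
  show "lower_semilattice_axioms (word_order S)"
    by unfold_locales (use greatest_path_min in auto)
qed

text \<open>The join is a \<open>SOME\<close> choice; uniqueness of least upper bounds identifies it
  with the explicit word.\<close>

lemma join_eq_path_max: "x \<in> S \<Longrightarrow> y \<in> S \<Longrightarrow> x \<squnion>\<^bsub>word_order S\<^esub> y = path_max x y"
  using joinI[of x y "\<lambda>z. z = path_max x y"] least_unique least_path_max by auto

lemma meet_eq_path_min: "x \<in> S \<Longrightarrow> y \<in> S \<Longrightarrow> x \<sqinter>\<^bsub>word_order S\<^esub> y = path_min x y"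
  using meetI[of x y "\<lambda>z. z = path_min x y"] greatest_unique greatest_path_min by auto

sublocale heyting_algebra "word_order S"
proof (rule finite_distributive_heyting_algebra)
  fix x y z
  assume "x \<in> carrier (word_order S)" "y \<in> carrier (word_order S)" "z \<in> carrier (word_order S)"
  then have xyz: "x \<in> S" "y \<in> S" "z \<in> S" by auto
  \<comment> \<open>At each prefix length this is distributivity of \<open>min\<close> over
    \<open>max\<close> on the natural numbers.\<close>
  then have "path_min x (path_max y z) = path_max (path_min x y) (path_min x z)"
    by (intro word_eqI_ups)
      (auto simp: length_mem ups_min ups_max path_min_closed path_max_closed min_max_distrib2)
  then show "x \<sqinter>\<^bsub>word_order S\<^esub> (y \<squnion>\<^bsub>word_order S\<^esub> z)
      = (x \<sqinter>\<^bsub>word_order S\<^esub> y) \<squnion>\<^bsub>word_order S\<^esub> (x \<sqinter>\<^bsub>word_order S\<^esub> z)"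
    using xyz by (simp add: join_eq_path_max meet_eq_path_min path_min_closed path_max_closed)
qed (use finite_family nonempty in auto)

end

section \<open>Dyck words\<close>

text \<open>A prefix of length \<open>j\<close> has \<open>j - ups w j\<close> right-steps, so the
  ballot condition becomes a lower bound on \<open>ups\<close>, which minima and maxima respect.
  Type A only adds a prescribed value at the end.\<close>

lemma dyck_B_iff: "w \<in> dyck_B n \<longleftrightarrow> length w = 2 * n \<and> (\<forall>j\<le>2 * n. j \<le> 2 * ups w j)"
proof -
  have "(\<forall>p. prefix p w \<longrightarrow> count_list p Right \<le> count_list p Up) \<longleftrightarrow>
      (\<forall>j\<le>length w. count_list (take j w) Right \<le> ups w j)"
    by (metis ups_def append_eq_conv_conj length_take min.absorb2 nat_le_linear prefix_def
        take_all take_is_prefix)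
  also have "\<dots> \<longleftrightarrow> (\<forall>j\<le>length w. j \<le> 2 * ups w j)"
    using ups_add_Right[of _ w] by (smt (verit) add_le_cancel_left mult_2)
  finally show ?thesis by (auto simp: dyck_B_def)
qed

lemma dyck_A_iff: "w \<in> dyck_A n \<longleftrightarrow> w \<in> dyck_B n \<and> ups w (2 * n) = n"
  by (auto simp: dyck_A_def dyck_B_def ups_def)

lemma path_min_dyck_B: "x \<in> dyck_B n \<Longrightarrow> y \<in> dyck_B n \<Longrightarrow> path_min x y \<in> dyck_B n"
  and path_max_dyck_B: "x \<in> dyck_B n \<Longrightarrow> y \<in> dyck_B n \<Longrightarrow> path_max x y \<in> dyck_B n"
  by (auto simp: dyck_B_iff ups_path_min ups_path_max min_def max_def)

lemma path_min_dyck_A: "x \<in> dyck_A n \<Longrightarrow> y \<in> dyck_A n \<Longrightarrow> path_min x y \<in> dyck_A n"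
  and path_max_dyck_A: "x \<in> dyck_A n \<Longrightarrow> y \<in> dyck_A n \<Longrightarrow> path_max x y \<in> dyck_A n"
  by (auto simp: dyck_A_iff path_min_dyck_B path_max_dyck_B)
    (auto simp: dyck_B_iff ups_path_min ups_path_max)

lemma ups_replicate_append:
  "ups (replicate a Up @ replicate b Right) j = min j a"
  by (simp add: ups_def count_list_eq_length_filter)

lemma replicate_mem_dyck_B: "replicate (2 * n) Up \<in> dyck_B n"
  using ups_replicate_append[of "2 * n" 0] by (auto simp: dyck_B_iff)

lemma replicate_mem_dyck_A: "replicate n Up @ replicate n Right \<in> dyck_A n"
  by (auto simp: dyck_A_iff dyck_B_iff ups_replicate_append)

interpretation B: path_family "dyck_B n" "2 * n" for n
proof
  show "dyck_B n \<noteq> {}" using replicate_mem_dyck_B by blast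
qed (auto simp: path_min_dyck_B path_max_dyck_B, simp add: dyck_B_def)

interpretation A: path_family "dyck_A n" "2 * n" for n
proof
  show "dyck_A n \<noteq> {}" using replicate_mem_dyck_A by blast
qed (auto simp: path_min_dyck_A path_max_dyck_A, simp add: dyck_A_def dyck_B_def)

section \<open>The involution \<open>psi\<close> and the symmetric words\<close>

lemma length_psi [simp]: "length (psi w) = length w"
  by (simp add: psi_def)

lemma swap_step_swap_step [simp]: "swap_step (swap_step s) = s"
  by (cases s) auto

lemma psi_psi [simp]: "psi (psi w) = w"
  by (simp add: psi_def rev_map comp_def)

lemma psi_append: "psi (u @ v) = psi v @ psi u"
  by (simp add: psi_def)

lemma count_list_psi_Up: "count_list (psi w) Up = count_list w Right"
proof -
  have "count_list (map swap_step w) (swap_step Right) = count_list w Right"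
    by (rule count_list_map_conv) (metis injI swap_step_swap_step)
  then show ?thesis by (simp add: psi_def)
qed

text \<open>The first \<open>j\<close> letters of \<open>psi w\<close> come from the last
  \<open>j\<close> letters of \<open>w\<close>, whose right-steps become up-steps. The additive form
  avoids truncated subtraction.\<close>

lemma ups_psi:
  assumes "j \<le> length w"
  shows "ups (psi w) j + count_list w Up = j + ups w (length w - j)"
proof -
  have "take j (psi w) = psi (drop (length w - j) w)"
    using assms by (simp add: psi_def take_rev drop_map)
  then have "ups (psi w) j = count_list (drop (length w - j) w) Right"
    by (simp add: ups_def count_list_psi_Up)
  moreover have "count_list (drop (length w - j) w) Up + count_list (drop (length w - j) w) Right = j"
    using assms by (simp add: count_list_Up_Right)
  moreover have "count_list w Up = ups w (length w - j) + count_list (drop (length w - j) w) Up"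
    unfolding ups_def by (metis append_take_drop_id count_list_append)
  ultimately show ?thesis by simp
qed

lemma ups_psi_dyck_A:
  assumes "w \<in> dyck_A n" "j \<le> 2 * n"
  shows "ups (psi w) j + n = j + ups w (2 * n - j)"
  using ups_psi[of j w] assms by (auto simp: dyck_A_def dyck_B_def)

lemma psi_dyck_A: "psi w \<in> dyck_A n" if w: "w \<in> dyck_A n"
proof -
  have "j \<le> 2 * ups (psi w) j" if "j \<le> 2 * n" for j
  proof -
    \<comment> \<open>The ballot condition for \<open>psi w\<close> at \<open>j\<close> is the one
      for \<open>w\<close> at the reflected length.\<close>
    have "2 * n - j \<le> 2 * ups w (2 * n - j)"
      using w by (simp add: dyck_A_iff dyck_B_iff)
    then show ?thesis using ups_psi_dyck_A[OF w that] that by linarith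
  qed
  moreover have "ups (psi w) (2 * n) = n" using ups_psi_dyck_A[OF w, of "2 * n"] by simp
  ultimately show ?thesis using w by (simp add: dyck_A_iff dyck_B_iff)
qed

lemma bij_betw_psi: "bij_betw psi (dyck_A n) (dyck_A n)"
  by (rule bij_betw_byWitness[where f' = psi]) (auto simp: psi_dyck_A)

text \<open>On type A, \<open>psi\<close> reflects the prefix length and shifts the count by
  \<open>j - n\<close>, the same for all words, so pointwise comparison is preserved. The converse
  follows because \<open>psi\<close> is an involution.\<close>

lemma dominance_psi_iff:
  assumes "x \<in> dyck_A n" "y \<in> dyck_A n"
  shows "dominance (psi x) (psi y) \<longleftrightarrow> dominance x y"
proof -
  have mono: "dominance (psi u) (psi v)" if uv: "u \<in> dyck_A n" "v \<in> dyck_A n" "dominance u v" for u v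
  proof -
    have "ups (psi u) j \<le> ups (psi v) j" if "j \<le> 2 * n" for j
    proof -
      have "ups u (2 * n - j) \<le> ups v (2 * n - j)" using uv by (simp add: A.dominance_iff)
      then show ?thesis
        using ups_psi_dyck_A[OF uv(1) that] ups_psi_dyck_A[OF uv(2) that] by linarith
    qed
    then show ?thesis using uv by (simp add: A.dominance_iff[where n = n] psi_dyck_A)
  qed
  show ?thesis
    using mono[of x y] mono[of "psi x" "psi y"] assms by (auto simp: psi_dyck_A)
qed

lemma symmetric_heyting_subalgebra:
  "heyting_subalgebra (symmetric_dyck_A m) (word_order (dyck_A m))"
  using A.fixed_points_heyting_subalgebra[of psi m] bij_betw_psi dominance_psi_iff
  by (simp add: symmetric_dyck_A_def)

text \<open>Everything follows from the subalgebra property: the bottom element gives nonemptiness,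
  and meets and joins in \<open>dyck_A m\<close> are \<open>path_min\<close> and
  \<open>path_max\<close>.\<close>

lemma path_family_symmetric: "path_family (symmetric_dyck_A m) (2 * m)"
proof
  show "length w = 2 * m" if "w \<in> symmetric_dyck_A m" for w
    using that by (simp add: symmetric_dyck_A_def A.length_mem)
  show "symmetric_dyck_A m \<noteq> {}"
    using symmetric_heyting_subalgebra[of m] by (auto simp: heyting_subalgebra_def)
  fix x y
  assume xy: "x \<in> symmetric_dyck_A m" "y \<in> symmetric_dyck_A m"
  then have "x \<in> dyck_A m" "y \<in> dyck_A m" by (auto simp: symmetric_dyck_A_def)
  then show "path_min x y \<in> symmetric_dyck_A m" "path_max x y \<in> symmetric_dyck_A m"
    using symmetric_heyting_subalgebra[of m] xy
    unfolding heyting_subalgebra_def by (metis A.join_eq_path_max A.meet_eq_path_min)+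
qed

section \<open>The doubling map \<open>phi\<close>\<close>

lemma ups_phi:
  assumes "j \<le> length w"
  shows "ups (phi w) j = ups w j"
    and "ups (phi w) (length w + j) = j + ups w (length w - j)"
proof -
  show "ups (phi w) j = ups w j" using assms by (simp add: phi_def ups_def)
  have "ups (phi w) (length w + j) = count_list w Up + ups (psi w) j"
    by (simp add: phi_def ups_def)
  \<comment> \<open>The total number of up-steps of \<open>w\<close> cancels, which is why type B
    words are allowed.\<close>
  then show "ups (phi w) (length w + j) = j + ups w (length w - j)"
    using ups_psi[OF assms] by simp
qed

lemma psi_phi [simp]: "psi (phi w) = phi w"
  by (simp add: phi_def psi_append)

lemma phi_mem_symmetric:
  assumes w: "w \<in> dyck_B n"
  shows "phi w \<in> symmetric_dyck_A (2 * n)"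
proof -
  have len: "length w = 2 * n" and pos: "\<And>j. j \<le> 2 * n \<Longrightarrow> j \<le> 2 * ups w j"
    using w by (auto simp: dyck_B_iff)
  have "j \<le> 2 * ups (phi w) j" if j: "j \<le> 2 * (2 * n)" for j
  proof (cases "j \<le> 2 * n")
    case True
    then show ?thesis using pos len by (simp add: ups_phi)
  next
    case False
    then obtain i where i: "j = 2 * n + i" "i \<le> 2 * n"
      using j by (metis add_le_cancel_left le_Suc_ex mult_2 nat_le_linear)
    then have "ups (phi w) j = i + ups w (2 * n - i)" using ups_phi(2)[of i w] len by simp
    moreover have "2 * n - i \<le> 2 * ups w (2 * n - i)" using pos by simp
    ultimately show ?thesis using i by linarith
  qed
  \<comment> \<open>At the end the reflected prefix of \<open>w\<close> is empty, so
    \<open>phi w\<close> is balanced whatever the final height of \<open>w\<close>.\<close>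
  moreover have "ups (phi w) (2 * (2 * n)) = 2 * n"
    using ups_phi(2)[of "2 * n" w] len by (simp flip: mult_2)
  moreover have "length (phi w) = 2 * (2 * n)" using len by (simp add: phi_def)
  ultimately show ?thesis by (simp add: symmetric_dyck_A_def dyck_A_iff dyck_B_iff)
qed

lemma bij_betw_phi: "bij_betw phi (dyck_B n) (symmetric_dyck_A (2 * n))"
proof (rule bij_betw_byWitness[where f' = "take (2 * n)"])
  show "\<forall>w\<in>dyck_B n. take (2 * n) (phi w) = w"
    by (auto simp: dyck_B_iff phi_def)
  show "\<forall>v\<in>symmetric_dyck_A (2 * n). phi (take (2 * n) v) = v"
  proof
    fix v assume "v \<in> symmetric_dyck_A (2 * n)"
    then have v: "psi v = v" "length v = 4 * n"
      by (auto simp: symmetric_dyck_A_def dyck_A_def dyck_B_def)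
    \<comment> \<open>By symmetry of \<open>v\<close>, its second half is \<open>psi\<close> of its
      first half.\<close>
    have "psi (take (2 * n) v) = drop (2 * n) (psi v)"
      using v(2) by (simp add: psi_def drop_rev take_map)
    then show "phi (take (2 * n) v) = v" using v by (simp add: phi_def)
  qed
  show "phi ` dyck_B n \<subseteq> symmetric_dyck_A (2 * n)" using phi_mem_symmetric by auto
  show "take (2 * n) ` symmetric_dyck_A (2 * n) \<subseteq> dyck_B n"
    by (auto simp: symmetric_dyck_A_def dyck_A_iff dyck_B_iff ups_def min_def)
qed

text \<open>The first half of the comparison is the one for \<open>x\<close> and \<open>y\<close>;
  the second half repeats it at reflected lengths with equal shifts on both sides.\<close>

lemma dominance_phi_iff:
  assumes xy: "x \<in> dyck_B n" "y \<in> dyck_B n"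
  shows "dominance (phi x) (phi y) \<longleftrightarrow> dominance x y"
proof -
  have len: "length x = 2 * n" "length y = 2 * n" using xy by (auto simp: dyck_B_iff)
  have mem: "phi x \<in> dyck_A (2 * n)" "phi y \<in> dyck_A (2 * n)"
    using phi_mem_symmetric xy by (auto simp: symmetric_dyck_A_def)
  have "(\<forall>j\<le>2 * (2 * n). ups (phi x) j \<le> ups (phi y) j) \<longleftrightarrow> (\<forall>j\<le>2 * n. ups x j \<le> ups y j)"
  proof
    assume "\<forall>j\<le>2 * (2 * n). ups (phi x) j \<le> ups (phi y) j"
    then show "\<forall>j\<le>2 * n. ups x j \<le> ups y j"
      using len by (auto simp flip: ups_phi(1))
  next
    assume le: "\<forall>j\<le>2 * n. ups x j \<le> ups y j"
    show "\<forall>j\<le>2 * (2 * n). ups (phi x) j \<le> ups (phi y) j"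
    proof (intro allI impI)
      fix j assume j: "j \<le> 2 * (2 * n)"
      show "ups (phi x) j \<le> ups (phi y) j"
      proof (cases "j \<le> 2 * n")
        case True
        then show ?thesis using le len by (simp add: ups_phi)
      next
        case False
        then obtain i where "j = 2 * n + i" "i \<le> 2 * n"
          using j by (metis add_le_cancel_left le_Suc_ex mult_2 nat_le_linear)
        then show ?thesis using ups_phi(2)[of i x] ups_phi(2)[of i y] le len by simp
      qed
    qed
  qed
  then show ?thesis using xy mem by (simp add: A.dominance_iff B.dominance_iff)
qed

text \<open>This is the element that keeps \<open>dyck_A n\<close> from being a Heyting subalgebra
  when \<open>n > 0\<close>.\<close>

lemma top_dyck_B: "\<top>\<^bsub>word_order (dyck_B n)\<^esub> = replicate (2 * n) Up"
proof (rule B.top_eq[symmetric])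
  fix x assume "x \<in> carrier (word_order (dyck_B n))"
  moreover have "ups x j \<le> j" for j
    using count_le_length[of "take j x" Up] by (simp add: ups_def)
  moreover have "ups (replicate (2 * n) Up) j = min j (2 * n)" for j
    using ups_replicate_append[of "2 * n" 0 j] by simp
  ultimately show "x \<sqsubseteq>\<^bsub>word_order (dyck_B n)\<^esub> replicate (2 * n) Up"
    by (simp add: B.dominance_iff replicate_mem_dyck_B)
qed (simp add: replicate_mem_dyck_B)

theorem theorem1p1:
  fixes n :: nat
  assumes "n > 0"
  shows "heyting_algebra (dyck_lattice_B n) \<and>
    sublattice (dyck_A n) (dyck_lattice_B n) \<and>
    heyting_algebra (dyck_lattice_A n) \<and>
    \<not> heyting_subalgebra (dyck_A n) (dyck_lattice_B n) \<and>
    lattice_iso (dyck_lattice_B n)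
      ((dyck_lattice_A (2 * n))\<lparr>carrier := symmetric_dyck_A (2 * n)\<rparr>) phi \<and>
    heyting_subalgebra (symmetric_dyck_A (2 * n)) (dyck_lattice_A (2 * n))"
proof -
  have sub: "dyck_A n \<subseteq> dyck_B n" by (auto simp: dyck_A_def)
  have "sublattice (dyck_A n) (word_order (dyck_B n))"
    unfolding sublattice_def
    using sub A.nonempty
    by (auto simp: subset_iff B.join_eq_path_max B.meet_eq_path_min
        A.path_min_closed A.path_max_closed)
  \<comment> \<open>Positivity of \<open>n\<close> separates \<open>2 * n\<close> from
    \<open>n\<close> up-steps; for \<open>n = 0\<close> both sets consist of the empty word.\<close>
  moreover have "replicate (2 * n) Up \<notin> dyck_A n"
    using assms by (simp add: dyck_A_def count_list_eq_length_filter)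
  then have "\<not> heyting_subalgebra (dyck_A n) (word_order (dyck_B n))"
    by (simp add: heyting_subalgebra_def top_dyck_B)
  moreover have "lattice_iso (word_order (dyck_B n)) (word_order (symmetric_dyck_A (2 * n))) phi"
  proof (rule order_iso_lattice_iso)
    interpret Sym: path_family "symmetric_dyck_A (2 * n)" "2 * (2 * n)"
      by (rule path_family_symmetric)
    show "lattice (word_order (symmetric_dyck_A (2 * n)))" by (rule Sym.lattice_axioms)
  qed (use B.lattice_axioms bij_betw_phi dominance_phi_iff in auto)
  ultimately show ?thesis
    using B.heyting_algebra_axioms A.heyting_algebra_axioms symmetric_heyting_subalgebra
    by (simp add: dyck_lattice_A_def dyck_lattice_B_def)
qed

end
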